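(* For any connected graph $G$ of order $n$, $2n+1\le\gamma_{rdR}(G\odot K_1)\le 3n$.
   Context: Graphs are finite, simple and have at least one vertex; the order of a graph is its number of vertices. A restrained double Roman dominating function (RDRD-function) of a graph $G$ is a function $f:V(G)\to\{0,1,2,3\}$ such that: (i) if $f(v)=0$, then $v$ has at least two neighbours assigned 2 under $f$ or at least one neighbour assigned 3; (ii) if $f(v)=1$, then $v$ has a neighbour $u$ with $f(u)\ge 2$; (iii) the subgraph of $G$ induced by the vertices assigned 0 contains no isolated vertex. The weight of $f$ is $\sum_{v\in V(G)}f(v)$, and $\gamma_{rdR}(G)$ is the minimum weight of an RDRD-function of $G$. The corona $G\odot K_1$ is the graph obtained from $G$ by adding, for each vertex $v\in V(G)$, a new leaf $v'$ adjacent only to $v$. *)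

theory Defs
  imports "Graph_Theory.Digraph_Component"
begin

text \<open>
  A finite simple graph is a \<^locale>\<open>pair_graph\<close>: a finite, loop-free, symmetric digraph
  without parallel arcs, each edge being represented by its two opposite arcs. The library
  allows the null graph there, but \<^const>\<open>Digraph_Component.connected\<close> excludes it.
\<close>

definition neighbours :: "('a, 'b) pre_digraph \<Rightarrow> 'a \<Rightarrow> 'a set" where
  "neighbours G v = {u \<in> verts G. v \<rightarrow>\<^bsub>G\<^esub> u}"

definition isolated_vertex :: "('a, 'b) pre_digraph \<Rightarrow> 'a \<Rightarrow> bool" where
  "isolated_vertex G v \<longleftrightarrow> v \<in> verts G \<and> neighbours G v = {}"

text \<open>The values of \<open>f\<close> outside the vertex set are irrelevant.\<close>

definition rdrd_function :: "('a, 'b) pre_digraph \<Rightarrow> ('a \<Rightarrow> nat) \<Rightarrow> bool" where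
  "rdrd_function G f \<longleftrightarrow>
     f ` verts G \<subseteq> {0, 1, 2, 3} \<and>
     (\<forall>v \<in> verts G. f v = 0 \<longrightarrow>
        card {u \<in> neighbours G v. f u = 2} \<ge> 2 \<or> (\<exists>u \<in> neighbours G v. f u = 3)) \<and>
     (\<forall>v \<in> verts G. f v = 1 \<longrightarrow> (\<exists>u \<in> neighbours G v. f u \<ge> 2)) \<and>
     (\<nexists>v. isolated_vertex (G \<restriction> {v \<in> verts G. f v = 0}) v)"

definition weight :: "('a, 'b) pre_digraph \<Rightarrow> ('a \<Rightarrow> nat) \<Rightarrow> nat" where
  "weight G f = (\<Sum>v \<in> verts G. f v)"

definition gamma_rdR :: "('a, 'b) pre_digraph \<Rightarrow> nat" where
  "gamma_rdR G = (LEAST w. \<exists>f. rdrd_function G f \<and> weight G f = w)"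

text \<open>The minimum exists: the constant function 2 is always an RDRD-function.\<close>

lemma rdrd_function_const_2: "rdrd_function G (\<lambda>_. 2)"
  by (auto simp: rdrd_function_def isolated_vertex_def)

lemma gamma_rdR_attained: "\<exists>f. rdrd_function G f \<and> weight G f = gamma_rdR G"
  unfolding gamma_rdR_def by (rule LeastI_ex) (use rdrd_function_const_2 in blast)

lemma gamma_rdR_le: "rdrd_function G f \<Longrightarrow> gamma_rdR G \<le> weight G f"
  unfolding gamma_rdR_def by (rule Least_le) blast

text \<open>\<open>Inl v\<close> is the original vertex \<open>v\<close>, and \<open>Inr v\<close> is the new leaf \<open>v'\<close> attached to it.\<close>

definition corona_K1 :: "'a pair_pre_digraph \<Rightarrow> ('a + 'a) pair_pre_digraph" where
  "corona_K1 G =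
     \<lparr> pverts = Inl ` pverts G \<union> Inr ` pverts G,
       parcs = {(Inl u, Inl v) | u v. (u, v) \<in> parcs G}
             \<union> {(Inl v, Inr v) | v. v \<in> pverts G}
             \<union> {(Inr v, Inl v) | v. v \<in> pverts G} \<rparr>"

lemma pair_graph_corona_K1:
  assumes "pair_graph G"
  shows "pair_graph (corona_K1 G)"
proof -
  interpret G: pair_graph G by fact
  have sub: "parcs (corona_K1 G) \<subseteq> pverts (corona_K1 G) \<times> pverts (corona_K1 G)"
    by (auto simp: corona_K1_def dest: G.in_arcsD1 G.in_arcsD2)
  have fin: "finite (pverts (corona_K1 G))"
    by (simp add: corona_K1_def)
  show ?thesis
  proof unfold_locales
    show "finite (parcs (corona_K1 G))"
      using sub fin by (meson finite_SigmaI finite_subset)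
    show "symmetric (with_proj (corona_K1 G))"
      by (auto simp: symmetric_def sym_def corona_K1_def intro: G.arcs_symmetric)
  qed (use fin in \<open>auto simp: corona_K1_def dest: G.in_arcsD1 G.in_arcsD2 G.no_loops'\<close>)
qed

end

theory Submission
  imports Defs
begin

text \<open>
  The vertices of \<open>G \<odot> K\<^sub>1\<close> split into \<open>n\<close> pairs consisting of a vertex \<open>v\<close> and its leaf \<open>v'\<close>, so
  both bounds reduce to the sums \<open>f v + f v'\<close>. Assigning 2 to every original vertex and 1 to
  every leaf is an RDRD-function and gives \<open>3n\<close>.

  For the lower bound, a leaf is never assigned 0: its only neighbour would have to be assigned
  3, and then the leaf would be isolated among the vertices assigned 0. A leaf assigned 1 forces
  \<open>f v \<ge> 2\<close>. So every pair contributes at least 2, with equality only if \<open>f v = 0\<close> and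
  \<open>f v' = 2\<close>. Equality cannot hold at every pair: all original vertices would be assigned 0, so each
  of them would have its leaf as the only neighbour with a nonzero value, and this value is only 2.
  As a connected graph has a vertex, some pair contributes at least 3.
\<close>

lemma neighbours_induce_subgraph_subset:
  assumes "S \<subseteq> verts G"
  shows "neighbours (G \<restriction> S) v \<subseteq> neighbours G v \<inter> S"
  using assms by (auto simp: neighbours_def arcs_ends_def arc_to_ends_def)

lemma neighbours_with_proj: "neighbours (with_proj G) v = {u \<in> pverts G. (v, u) \<in> parcs G}"
  by (simp add: neighbours_def)

lemma neighbours_corona_K1_Inr:
  assumes "v \<in> pverts G"
  shows "neighbours (with_proj (corona_K1 G)) (Inr v) = {Inl v}"
  using assms by (auto simp: neighbours_with_proj corona_K1_def)

lemma neighbours_corona_K1_Inl: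
  assumes "v \<in> pverts G"
  shows "neighbours (with_proj (corona_K1 G)) (Inl v)
       = insert (Inr v) (Inl ` neighbours (with_proj G) v)"
  using assms by (auto simp: neighbours_with_proj corona_K1_def)

lemma weight_corona_K1:
  assumes "finite (pverts G)"
  shows "weight (with_proj (corona_K1 G)) f = (\<Sum>v \<in> pverts G. f (Inl v) + f (Inr v))"
proof -
  have "weight (with_proj (corona_K1 G)) f
      = sum f (Inl ` pverts G) + sum f (Inr ` pverts G)"
    unfolding weight_def using assms
    by (simp add: corona_K1_def) (rule sum.union_disjoint; auto)
  then show ?thesis
    by (simp add: sum.reindex sum.distrib)
qed

lemma rdrd_function_zeroD:
  assumes "rdrd_function G f" "v \<in> verts G" "f v = 0"
  shows "card {u \<in> neighbours G v. f u = 2} \<ge> 2 \<or> (\<exists>u \<in> neighbours G v. f u = 3)"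
  using assms by (simp add: rdrd_function_def)

lemma rdrd_function_corona_K1_2_1:
  "rdrd_function (with_proj (corona_K1 G)) (case_sum (\<lambda>_. 2) (\<lambda>_. 1))"
proof -
  let ?f = "case_sum (\<lambda>_. 2) (\<lambda>_. 1) :: 'a + 'a \<Rightarrow> nat"
  have pos: "?f x \<noteq> 0" for x
    by (cases x) auto
  show ?thesis
    unfolding rdrd_function_def isolated_vertex_def
    by (auto simp: pos) (auto simp: corona_K1_def neighbours_with_proj)
qed

text \<open>
  Condition (iii) excludes the value 0 here, because the only neighbour of a leaf assigned 0 is
  assigned 3 by condition (i).
\<close>

lemma rdrd_function_leaf_pos:
  assumes f: "rdrd_function G f" and v: "v \<in> verts G" and leaf: "neighbours G v = {u}"
  shows "f v > 0"
proof (rule ccontr)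
  assume "\<not> f v > 0"
  then have zero: "f v = 0" by simp
  have "card {x \<in> neighbours G v. f x = 2} \<le> 1"
    unfolding leaf by (rule order_trans[OF card_mono[of "{u}"]]) auto
  with rdrd_function_zeroD[OF f v zero] have "f u = 3"
    by (auto simp: leaf)
  then have "neighbours (G \<restriction> {x \<in> verts G. f x = 0}) v = {}"
    using neighbours_induce_subgraph_subset[of "{x \<in> verts G. f x = 0}" G v] leaf by auto
  with f v zero show False
    by (auto simp: rdrd_function_def isolated_vertex_def)
qed

lemma rdrd_function_leaf_cases:
  assumes f: "rdrd_function G f" and v: "v \<in> verts G" and leaf: "neighbours G v = {u}"
  shows "f u + f v \<ge> 3 \<or> f u = 0 \<and> f v = 2"
proof (cases "f v = 1")
  case True
  with f v leaf show ?thesis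
    by (auto simp: rdrd_function_def)
next
  case False
  moreover have "f v \<in> {0, 1, 2, 3}"
    using f v by (auto simp: rdrd_function_def)
  ultimately show ?thesis
    using rdrd_function_leaf_pos[OF assms] by auto
qed

text \<open>
  The pairs with sum 2 are the only obstacle to a weight of at least \<open>3n\<close>, and they cannot fill the
  graph: a vertex assigned 0 whose leaf is assigned 2 needs another neighbour with a nonzero
  value, which is again an original vertex.
\<close>

lemma rdrd_function_corona_K1_exists_heavy_pair:
  assumes f: "rdrd_function (with_proj (corona_K1 G)) f" and v: "v \<in> pverts G"
  shows "\<exists>u \<in> pverts G. f (Inl u) + f (Inr u) \<ge> 3"
proof (rule ccontr)
  let ?H = "with_proj (corona_K1 G)"
  assume light: "\<not> ?thesis"
  have val: "f (Inl u) = 0 \<and> f (Inr u) = 2" if u: "u \<in> pverts G" for u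
  proof -
    have "Inr u \<in> verts ?H"
      using u by (simp add: corona_K1_def)
    from rdrd_function_leaf_cases[OF f this neighbours_corona_K1_Inr[OF u]] light u
    show ?thesis by auto
  qed
  have nb: "x = Inr v \<or> f x = 0" if "x \<in> neighbours ?H (Inl v)" for x
    using that val unfolding neighbours_corona_K1_Inl[OF v]
    by (auto simp: neighbours_with_proj)
  have "card {x \<in> neighbours ?H (Inl v). f x = 2} \<le> card {Inr v :: 'a + 'a}"
    by (rule card_mono) (use nb in force)+
  moreover have "f x \<noteq> 3" if "x \<in> neighbours ?H (Inl v)" for x
    using nb[OF that] val[OF v] by auto
  moreover have "Inl v \<in> verts ?H"
    using v by (simp add: corona_K1_def)
  ultimately show False
    using rdrd_function_zeroD[OF f, of "Inl v"] val[OF v] by auto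
qed

lemma weight_corona_K1_lower_bound:
  assumes f: "rdrd_function (with_proj (corona_K1 G)) f"
    and fin: "finite (pverts G)" and ne: "pverts G \<noteq> {}"
  shows "2 * card (pverts G) + 1 \<le> weight (with_proj (corona_K1 G)) f"
proof -
  have pair: "f (Inl v) + f (Inr v) \<ge> 2" if v: "v \<in> pverts G" for v
  proof -
    have "Inr v \<in> verts (with_proj (corona_K1 G))"
      using v by (simp add: corona_K1_def)
    from rdrd_function_leaf_cases[OF f this neighbours_corona_K1_Inr[OF v]]
    show ?thesis by auto
  qed
  obtain u where "u \<in> pverts G" "f (Inl u) + f (Inr u) \<ge> 3"
    using rdrd_function_corona_K1_exists_heavy_pair[OF f] ne by blast
  then have "(\<Sum>v \<in> pverts G. 2) < (\<Sum>v \<in> pverts G. f (Inl v) + f (Inr v))"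
    using pair by (intro sum_strict_mono_ex1[OF fin]) force+
  then show ?thesis
    by (simp add: weight_corona_K1[OF fin])
qed

theorem theorem5p2:
  fixes G :: "'a pair_pre_digraph" and n :: nat
  assumes "pair_graph G"
    and "Digraph_Component.connected (with_proj G)"
    and "card (pverts G) = n"
  shows "2 * n + 1 \<le> gamma_rdR (with_proj (corona_K1 G))
       \<and> gamma_rdR (with_proj (corona_K1 G)) \<le> 3 * n"
proof
  interpret pair_graph G by fact
  let ?H = "with_proj (corona_K1 G)"
  have fin: "finite (pverts G)" by (rule pair_finite_verts)
  have ne: "pverts G \<noteq> {}"
    using assms(2) by (auto simp: connected_def strongly_connected_def)
  obtain f where f: "rdrd_function ?H f" and "weight ?H f = gamma_rdR ?H"
    using gamma_rdR_attained by blast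
  with weight_corona_K1_lower_bound[OF f fin ne] assms(3)
  show "2 * n + 1 \<le> gamma_rdR ?H" by simp
  have "gamma_rdR ?H \<le> weight ?H (case_sum (\<lambda>_. 2) (\<lambda>_. 1))"
    by (rule gamma_rdR_le[OF rdrd_function_corona_K1_2_1])
  also have "\<dots> = 3 * n"
    by (simp add: weight_corona_K1[OF fin] assms(3))
  finally show "gamma_rdR ?H \<le> 3 * n" .
qed

end
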